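(* Let $T$ be a normal lax monad on a thin equipment $\mathcal K$. Let $A$, $B$ and $M$ be $T$-graphs, $e\colon B\to M$ a $T$-morphism and $J\colon A\nrightarrow B$ a $T$-open horizontal morphism. The right Kan extension $r\colon A\to M$ of $e$ along $J$ in $\mathcal K$, if it exists, is a $T$-morphism whenever it satisfies the Beck–Chevalley condition. Moreover, in that case $r$ is $T$-closed as soon as both $e$ and $J$ are $T$-closed, provided that $TJ\odot T(e_* )=T(J\odot e_* )$.
   Context: A thin equipment $\mathcal K$ consists of two categories on the same collection of objects: one with composition $\circ$ and identities $\mathrm{id}$, whose morphisms $f\colon A\to C$ are called vertical, and one with composition $\odot$ (written in diagrammatic order) and identities $1_A$, whose morphisms $J\colon A\nrightarrow B$ are called horizontal; together with a collection of cells. A cell has a boundary consisting of a top $J\colon A\nrightarrow B$, a bottom $K\colon C\nrightarrow D$, a left side $f\colon A\to C$ and a right side $g\colon B\to D$, and is uniquely determined by its boundary; write $J\Rightarrow_{f,g}K$ if the cell with this boundary exists. The axioms are: (i) $J\Rightarrow_{f,g}K$ and $K\Rightarrow_{h,k}L$ imply $J\Rightarrow_{h\circ f,k\circ g}L$, and $J\Rightarrow_{f,g}K$ and $H\Rightarrow_{g,l}N$ imply $J\odot H\Rightarrow_{f,l}K\odot N$; (ii) $1_A\Rightarrow_{f,f}1_C$ for all $f\colon A\to C$ and $J\Rightarrow_{\mathrm{id},\mathrm{id}}J$ for all $J$; (iii) writing $J\le K$ for $J\Rightarrow_{\mathrm{id},\mathrm{id}}K$, if $J\le K$ and $K\le J$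 then $J=K$; (iv) each vertical $f\colon A\to C$ has a companion $f_*\colon A\nrightarrow C$ with $f_*\Rightarrow_{f,\mathrm{id}_C}1_C$ and $1_A\Rightarrow_{\mathrm{id}_A,f}f_*$, and a conjoint $f^*\colon C\nrightarrow A$ with $f^*\Rightarrow_{\mathrm{id}_C,f}1_C$ and $1_A\Rightarrow_{f,\mathrm{id}_A}f^*$ (these are necessarily unique). A lax functor $F$ between thin equipments consists of a functor on the vertical categories together with an assignment $(J\colon A\nrightarrow B)\mapsto(FJ\colon FA\nrightarrow FB)$ such that $1_{FA}\le F1_A$, $FJ\odot FH\le F(J\odot H)$, and $J\Rightarrow_{f,g}K$ implies $FJ\Rightarrow_{Ff,Fg}FK$. It is normal if $F1_A=1_{FA}$ for all $A$ (then $F(f_* )=(Ff)_*$ and $F(f^* )=(Ff)^*$). A transformation $\xi\colon F\Rightarrow G$ of lax functors is a natural transformation between the vertical functors such that $FJ\Rightarrow_{\xi_A,\xi_B}GJ$ for every $J\colon A\nrightarrow B$. A lax monad $T=(T,\mu,\iota)$ on $\mathcal K$ is a lax functor $T\colon\mathcal K\to\mathcal K$ with transformations $\mu\colon T^2\Rightarrow T$ and $\iota\colon\mathrm{id}_{\mathcal K}\Rightarrow T$ satisfying the usual monad associativity and unit axioms; it is normal if its underlying lax functor is. A $T$-graph is an object $A$ with a horizontal morphism $\alpha\colon TA\nrightarrow A$ such that $1_A\Rightarrow_{\iota_A,\mathrm{id}_A}\alpha$. A $T$-morphism $f\colon(A,\alpha)\to(C,\gamma)$ is a vertical morphism $f\colon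 A\to C$ with $\alpha\Rightarrow_{Tf,f}\gamma$. A horizontal morphism $J\colon A\nrightarrow B$ between $T$-graphs $(A,\alpha)$ and $(B,\beta)$ is $T$-open if $\alpha\odot J\le TJ\odot\beta$, and $T$-closed if $TJ\odot\beta\le\alpha\odot J$. A $T$-morphism $f\colon(A,\alpha)\to(C,\gamma)$ is $T$-closed if its companion $f_*\colon A\nrightarrow C$ is $T$-closed, i.e. $(Tf)_*\odot\gamma\le\alpha\odot f_*$. Given $e\colon B\to M$ and $J\colon A\nrightarrow B$, a vertical morphism $r\colon A\to M$ is the right Kan extension of $e$ along $J$ if $J\Rightarrow_{r,e}1_M$ and, for all $H\colon C\nrightarrow A$ and $f\colon C\to M$, $H\odot J\Rightarrow_{f,e}1_M$ implies $H\Rightarrow_{f,r}1_M$. It satisfies the Beck–Chevalley condition if $J\odot e_*=r_*$. *)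

theory Defs imports Main begin

text \<open>Composition \<open>comp f g\<close> in \<open>category_on\<close> is in diagrammatic order: first \<open>f\<close>, then \<open>g\<close>.\<close>

locale category_on =
  fixes Ob :: "'o set" and Ar :: "'a set"
    and dm :: "'a \<Rightarrow> 'o" and cd :: "'a \<Rightarrow> 'o"
    and comp :: "'a \<Rightarrow> 'a \<Rightarrow> 'a" and idn :: "'o \<Rightarrow> 'a"
  assumes dm_in: "f \<in> Ar \<Longrightarrow> dm f \<in> Ob"
    and cd_in: "f \<in> Ar \<Longrightarrow> cd f \<in> Ob"
    and id_in: "A \<in> Ob \<Longrightarrow> idn A \<in> Ar"
    and dm_id: "A \<in> Ob \<Longrightarrow> dm (idn A) = A"
    and cd_id: "A \<in> Ob \<Longrightarrow> cd (idn A) = A"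
    and comp_in: "\<lbrakk>f \<in> Ar; g \<in> Ar; cd f = dm g\<rbrakk> \<Longrightarrow> comp f g \<in> Ar"
    and dm_comp: "\<lbrakk>f \<in> Ar; g \<in> Ar; cd f = dm g\<rbrakk> \<Longrightarrow> dm (comp f g) = dm f"
    and cd_comp: "\<lbrakk>f \<in> Ar; g \<in> Ar; cd f = dm g\<rbrakk> \<Longrightarrow> cd (comp f g) = cd g"
    and comp_id_left: "f \<in> Ar \<Longrightarrow> comp (idn (dm f)) f = f"
    and comp_id_right: "f \<in> Ar \<Longrightarrow> comp f (idn (cd f)) = f"
    and comp_assoc: "\<lbrakk>f \<in> Ar; g \<in> Ar; h \<in> Ar; cd f = dm g; cd g = dm h\<rbrakk>
      \<Longrightarrow> comp (comp f g) h = comp f (comp g h)"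

text \<open>Since a cell is determined by its boundary, the cells form a relation:
  \<open>cell K J f g L\<close> says that the cell with top \<open>J\<close>, left side \<open>f\<close>, right side \<open>g\<close> and
  bottom \<open>L\<close> exists. Vertical composition \<open>h \<cdot>\<^bsub>K\<^esub> f\<close> is in applicative order (first \<open>f\<close>),
  horizontal composition \<open>J \<odot>\<^bsub>K\<^esub> H\<close> in diagrammatic order (first \<open>J\<close>).\<close>

record ('o, 'v, 'h) equipment =
  Obj :: "'o set"
  Ver :: "'v set"
  vdom :: "'v \<Rightarrow> 'o"
  vcod :: "'v \<Rightarrow> 'o"
  vcomp :: "'v \<Rightarrow> 'v \<Rightarrow> 'v" (infixl "\<cdot>\<index>" 70)
  vid :: "'o \<Rightarrow> 'v"
  Hor :: "'h set"
  hsrc :: "'h \<Rightarrow> 'o"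
  htgt :: "'h \<Rightarrow> 'o"
  hcomp :: "'h \<Rightarrow> 'h \<Rightarrow> 'h" (infixl "\<odot>\<index>" 70)
  hid :: "'o \<Rightarrow> 'h"
  cell :: "'h \<Rightarrow> 'v \<Rightarrow> 'v \<Rightarrow> 'h \<Rightarrow> bool"

definition vert :: "('o, 'v, 'h) equipment \<Rightarrow> 'v \<Rightarrow> 'o \<Rightarrow> 'o \<Rightarrow> bool" where
  "vert K f A C \<longleftrightarrow> f \<in> Ver K \<and> vdom K f = A \<and> vcod K f = C"

definition hor :: "('o, 'v, 'h) equipment \<Rightarrow> 'h \<Rightarrow> 'o \<Rightarrow> 'o \<Rightarrow> bool" where
  "hor K J A B \<longleftrightarrow> J \<in> Hor K \<and> hsrc K J = A \<and> htgt K J = B"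

definition hle :: "('o, 'v, 'h) equipment \<Rightarrow> 'h \<Rightarrow> 'h \<Rightarrow> bool" where
  "hle K J L \<longleftrightarrow> cell K J (vid K (hsrc K J)) (vid K (htgt K J)) L"

notation hle ("(_ \<preceq>\<index> _)" [51, 51] 50)

definition is_companion :: "('o, 'v, 'h) equipment \<Rightarrow> 'v \<Rightarrow> 'h \<Rightarrow> bool" where
  "is_companion K f J \<longleftrightarrow>
     hor K J (vdom K f) (vcod K f) \<and>
     cell K J f (vid K (vcod K f)) (hid K (vcod K f)) \<and>
     cell K (hid K (vdom K f)) (vid K (vdom K f)) f J"

definition is_conjoint :: "('o, 'v, 'h) equipment \<Rightarrow> 'v \<Rightarrow> 'h \<Rightarrow> bool" where
  "is_conjoint K f J \<longleftrightarrow>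
     hor K J (vcod K f) (vdom K f) \<and>
     cell K J (vid K (vcod K f)) f (hid K (vcod K f)) \<and>
     cell K (hid K (vdom K f)) f (vid K (vdom K f)) J"

text \<open>The assumption \<open>cell_boundary\<close> says that every cell has a well-formed boundary; in
  particular it makes the composites in \<open>cell_vcomp\<close> and \<open>cell_hcomp\<close> meaningful.\<close>

locale thin_equipment =
  fixes K :: "('o, 'v, 'h) equipment" (structure)
  assumes vertical_category:
      "category_on (Obj K) (Ver K) (vdom K) (vcod K) (\<lambda>f g. g \<cdot> f) (vid K)"
    and horizontal_category:
      "category_on (Obj K) (Hor K) (hsrc K) (htgt K) (\<odot>) (hid K)"
    and cell_boundary: "cell K J f g L \<Longrightarrow>
      hor K J (vdom K f) (vdom K g) \<and> hor K L (vcod K f) (vcod K g) \<and>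
      f \<in> Ver K \<and> g \<in> Ver K"
    and cell_vcomp: "\<lbrakk>cell K J f g L; cell K L h k N\<rbrakk> \<Longrightarrow> cell K J (h \<cdot> f) (k \<cdot> g) N"
    and cell_hcomp: "\<lbrakk>cell K J f g L; cell K H g l N\<rbrakk> \<Longrightarrow> cell K (J \<odot> H) f l (L \<odot> N)"
    and cell_hid: "vert K f A C \<Longrightarrow> cell K (hid K A) f f (hid K C)"
    and cell_refl: "hor K J A B \<Longrightarrow> cell K J (vid K A) (vid K B) J"
    and hle_antisym: "\<lbrakk>J \<preceq> L; L \<preceq> J\<rbrakk> \<Longrightarrow> J = L"
    and companion_exists: "f \<in> Ver K \<Longrightarrow> \<exists>J. is_companion K f J"
    and conjoint_exists: "f \<in> Ver K \<Longrightarrow> \<exists>J. is_conjoint K f J"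

definition companion :: "('o, 'v, 'h) equipment \<Rightarrow> 'v \<Rightarrow> 'h" where
  "companion K f = (THE J. is_companion K f J)"

lemma (in thin_equipment) companion_hle:
  assumes f: "f \<in> Ver K" and J: "is_companion K f J" and L: "is_companion K f L"
  shows "J \<preceq> L"
proof -
  interpret h: category_on "Obj K" "Hor K" "hsrc K" "htgt K" "(\<odot>)" "hid K"
    by (rule horizontal_category)
  have "cell K (hid K (vdom K f) \<odot> J) (vid K (vdom K f)) (vid K (vcod K f))
          (L \<odot> hid K (vcod K f))"
    using cell_hcomp J L unfolding is_companion_def by blast
  moreover have "hid K (vdom K f) \<odot> J = J" "L \<odot> hid K (vcod K f) = L"
    using J L h.comp_id_left[of J] h.comp_id_right[of L]
    unfolding is_companion_def hor_def by auto
  ultimately show ?thesis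
    using J unfolding hle_def is_companion_def hor_def by simp
qed

lemma (in thin_equipment) is_companion_companion:
  assumes "f \<in> Ver K"
  shows "is_companion K f (companion K f)"
  unfolding companion_def
  using companion_exists[OF assms] companion_hle[OF assms] hle_antisym
  by (metis (no_types, lifting) theI)

lemma (in thin_equipment) hle_trans:
  assumes JL: "J \<preceq> L" and LN: "L \<preceq> N"
  shows "J \<preceq> N"
proof -
  interpret v: category_on "Obj K" "Ver K" "vdom K" "vcod K" "\<lambda>f g. g \<cdot> f" "vid K"
    by (rule vertical_category)
  interpret h: category_on "Obj K" "Hor K" "hsrc K" "htgt K" "(\<odot>)" "hid K"
    by (rule horizontal_category)
  have J: "J \<in> Hor K"
    using cell_boundary[OF JL[unfolded hle_def]] by (simp add: hor_def)
  let ?A = "hsrc K J" and ?B = "htgt K J"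
  have A: "?A \<in> Obj K" and B: "?B \<in> Obj K"
    using J h.dm_in h.cd_in by auto
  have L: "hsrc K L = ?A" "htgt K L = ?B"
    using cell_boundary[OF JL[unfolded hle_def]] v.cd_id[OF A] v.cd_id[OF B]
    by (simp_all add: hor_def)
  have "cell K J (vid K ?A \<cdot> vid K ?A) (vid K ?B \<cdot> vid K ?B) N"
    using cell_vcomp JL LN L unfolding hle_def by metis
  moreover have "vid K ?A \<cdot> vid K ?A = vid K ?A" "vid K ?B \<cdot> vid K ?B = vid K ?B"
    using v.comp_id_left[OF v.id_in[OF A]] v.comp_id_left[OF v.id_in[OF B]]
      v.dm_id A B by simp_all
  ultimately show ?thesis unfolding hle_def by simp
qed

record ('o, 'v, 'h, 'p, 'w, 'k) efunctor =
  onO :: "'o \<Rightarrow> 'p"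
  onV :: "'v \<Rightarrow> 'w"
  onH :: "'h \<Rightarrow> 'k"

locale lax_functor =
  dom: thin_equipment K + cod: thin_equipment L
  for K :: "('o, 'v, 'h) equipment" and L :: "('p, 'w, 'k) equipment" +
  fixes F :: "('o, 'v, 'h, 'p, 'w, 'k) efunctor"
  assumes onO_in: "A \<in> Obj K \<Longrightarrow> onO F A \<in> Obj L"
    and onV_vert: "vert K f A C \<Longrightarrow> vert L (onV F f) (onO F A) (onO F C)"
    and onV_vid: "A \<in> Obj K \<Longrightarrow> onV F (vid K A) = vid L (onO F A)"
    and onV_vcomp: "\<lbrakk>vert K f A C; vert K g C D\<rbrakk>
      \<Longrightarrow> onV F (g \<cdot>\<^bsub>K\<^esub> f) = onV F g \<cdot>\<^bsub>L\<^esub> onV F f"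
    and onH_hor: "hor K J A B \<Longrightarrow> hor L (onH F J) (onO F A) (onO F B)"
    and onH_hid: "A \<in> Obj K \<Longrightarrow> hid L (onO F A) \<preceq>\<^bsub>L\<^esub> onH F (hid K A)"
    and onH_hcomp: "\<lbrakk>hor K J A B; hor K H B E\<rbrakk>
      \<Longrightarrow> onH F J \<odot>\<^bsub>L\<^esub> onH F H \<preceq>\<^bsub>L\<^esub> onH F (J \<odot>\<^bsub>K\<^esub> H)"
    and on_cell: "cell K J f g H \<Longrightarrow> cell L (onH F J) (onV F f) (onV F g) (onH F H)"

definition normal ::
  "('o, 'v, 'h) equipment \<Rightarrow> ('p, 'w, 'k) equipment \<Rightarrow> ('o, 'v, 'h, 'p, 'w, 'k) efunctor \<Rightarrow> bool"
  where "normal K L F \<longleftrightarrow> (\<forall>A\<in>Obj K. onH F (hid K A) = hid L (onO F A))"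

definition id_functor :: "('o, 'v, 'h, 'o, 'v, 'h) efunctor" where
  "id_functor = \<lparr>onO = (\<lambda>A. A), onV = (\<lambda>f. f), onH = (\<lambda>J. J)\<rparr>"

definition comp_functor ::
  "('p, 'w, 'k, 'q, 'x, 'l) efunctor \<Rightarrow> ('o, 'v, 'h, 'p, 'w, 'k) efunctor
    \<Rightarrow> ('o, 'v, 'h, 'q, 'x, 'l) efunctor" where
  "comp_functor G F =
     \<lparr>onO = onO G \<circ> onO F, onV = onV G \<circ> onV F, onH = onH G \<circ> onH F\<rparr>"

lemma (in lax_functor) onH_mono:
  assumes "J \<preceq>\<^bsub>K\<^esub> H"
  shows "onH F J \<preceq>\<^bsub>L\<^esub> onH F H"
proof -
  interpret h: category_on "Obj K" "Hor K" "hsrc K" "htgt K" "(\<odot>\<^bsub>K\<^esub>)" "hid K"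
    by (rule dom.horizontal_category)
  have J: "J \<in> Hor K"
    using dom.cell_boundary[OF assms[unfolded hle_def]] by (simp add: hor_def)
  then have ob: "hsrc K J \<in> Obj K" "htgt K J \<in> Obj K"
    using h.dm_in h.cd_in by auto
  have "hor L (onH F J) (onO F (hsrc K J)) (onO F (htgt K J))"
    using onH_hor J by (simp add: hor_def)
  then show ?thesis
    using on_cell[OF assms[unfolded hle_def]] onV_vid ob by (simp add: hle_def hor_def)
qed

lemma lax_functor_id:
  assumes "thin_equipment K"
  shows "lax_functor K K id_functor"
proof -
  interpret thin_equipment K by (rule assms)
  interpret h: category_on "Obj K" "Hor K" "hsrc K" "htgt K" "(\<odot>\<^bsub>K\<^esub>)" "hid K"
    by (rule horizontal_category)
  have refl: "J \<preceq>\<^bsub>K\<^esub> J" if "J \<in> Hor K" for J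
    using cell_refl that unfolding hle_def hor_def by blast
  show ?thesis
    by unfold_locales (auto simp: id_functor_def hor_def intro!: refl h.id_in h.comp_in)
qed

lemma lax_functor_comp:
  assumes "lax_functor K L F" and "lax_functor L N G"
  shows "lax_functor K N (comp_functor G F)"
proof -
  interpret F: lax_functor K L F by (rule assms(1))
  interpret G: lax_functor L N G by (rule assms(2))
  show ?thesis
  proof unfold_locales
    fix A assume A: "A \<in> Obj K"
    show "hid N (onO (comp_functor G F) A) \<preceq>\<^bsub>N\<^esub> onH (comp_functor G F) (hid K A)"
      using G.cod.hle_trans[OF G.onH_hid[OF F.onO_in[OF A]] G.onH_mono[OF F.onH_hid[OF A]]]
      by (simp add: comp_functor_def)
  next
    fix J A B H E assume J: "hor K J A B" and H: "hor K H B E"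
    show "onH (comp_functor G F) J \<odot>\<^bsub>N\<^esub> onH (comp_functor G F) H
        \<preceq>\<^bsub>N\<^esub> onH (comp_functor G F) (J \<odot>\<^bsub>K\<^esub> H)"
      using G.cod.hle_trans[OF G.onH_hcomp[OF F.onH_hor[OF J] F.onH_hor[OF H]]
          G.onH_mono[OF F.onH_hcomp[OF J H]]]
      by (simp add: comp_functor_def)
  next
    fix f g A C D assume fg: "vert K f A C" "vert K g C D"
    show "onV (comp_functor G F) (g \<cdot>\<^bsub>K\<^esub> f)
        = onV (comp_functor G F) g \<cdot>\<^bsub>N\<^esub> onV (comp_functor G F) f"
      using F.onV_vcomp[OF fg] G.onV_vcomp[OF F.onV_vert F.onV_vert, OF fg]
      by (simp add: comp_functor_def)
  qed (auto simp: comp_functor_def F.onO_in G.onO_in F.onV_vert G.onV_vert F.onV_vid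
      G.onV_vid F.onH_hor G.onH_hor F.on_cell G.on_cell)
qed

locale transformation =
  F: lax_functor K L F + G: lax_functor K L G
  for K :: "('o, 'v, 'h) equipment" and L :: "('p, 'w, 'k) equipment"
    and F :: "('o, 'v, 'h, 'p, 'w, 'k) efunctor" and G :: "('o, 'v, 'h, 'p, 'w, 'k) efunctor" +
  fixes \<xi> :: "'o \<Rightarrow> 'w"
  assumes component_vert: "A \<in> Obj K \<Longrightarrow> vert L (\<xi> A) (onO F A) (onO G A)"
    and naturality: "vert K f A C \<Longrightarrow> \<xi> C \<cdot>\<^bsub>L\<^esub> onV F f = onV G f \<cdot>\<^bsub>L\<^esub> \<xi> A"
    and component_cell: "hor K J A B \<Longrightarrow> cell L (onH F J) (\<xi> A) (\<xi> B) (onH G J)"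

locale lax_monad =
  T: lax_functor K K T +
  \<mu>: transformation K K "comp_functor T T" T \<mu> +
  \<iota>: transformation K K id_functor T \<iota>
  for K :: "('o, 'v, 'h) equipment" and T :: "('o, 'v, 'h, 'o, 'v, 'h) efunctor"
    and \<mu> :: "'o \<Rightarrow> 'v" and \<iota> :: "'o \<Rightarrow> 'v" +
  assumes monad_assoc: "A \<in> Obj K \<Longrightarrow> \<mu> A \<cdot>\<^bsub>K\<^esub> onV T (\<mu> A) = \<mu> A \<cdot>\<^bsub>K\<^esub> \<mu> (onO T A)"
    and monad_unit_left: "A \<in> Obj K \<Longrightarrow> \<mu> A \<cdot>\<^bsub>K\<^esub> \<iota> (onO T A) = vid K (onO T A)"
    and monad_unit_right: "A \<in> Obj K \<Longrightarrow> \<mu> A \<cdot>\<^bsub>K\<^esub> onV T (\<iota> A) = vid K (onO T A)"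

locale normal_lax_monad = lax_monad +
  assumes normal: "normal K K T"

text \<open>A \<open>T\<close>-graph is passed around as an object \<open>A\<close> together with its structure
  morphism \<open>\<alpha>\<close>. The notions below do not repeat the requirement that the objects involved
  are \<open>T\<close>-graphs.\<close>

definition T_graph ::
  "('o, 'v, 'h) equipment \<Rightarrow> ('o, 'v, 'h, 'o, 'v, 'h) efunctor \<Rightarrow> ('o \<Rightarrow> 'v) \<Rightarrow> 'o \<Rightarrow> 'h \<Rightarrow> bool"
  where "T_graph K T \<iota> A \<alpha> \<longleftrightarrow>
     A \<in> Obj K \<and> hor K \<alpha> (onO T A) A \<and> cell K (hid K A) (\<iota> A) (vid K A) \<alpha>"

definition T_morphism ::
  "('o, 'v, 'h) equipment \<Rightarrow> ('o, 'v, 'h, 'o, 'v, 'h) efunctor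
    \<Rightarrow> 'o \<Rightarrow> 'h \<Rightarrow> 'o \<Rightarrow> 'h \<Rightarrow> 'v \<Rightarrow> bool"
  where "T_morphism K T A \<alpha> C \<gamma> f \<longleftrightarrow> vert K f A C \<and> cell K \<alpha> (onV T f) f \<gamma>"

definition T_open ::
  "('o, 'v, 'h) equipment \<Rightarrow> ('o, 'v, 'h, 'o, 'v, 'h) efunctor
    \<Rightarrow> 'o \<Rightarrow> 'h \<Rightarrow> 'o \<Rightarrow> 'h \<Rightarrow> 'h \<Rightarrow> bool"
  where "T_open K T A \<alpha> B \<beta> J \<longleftrightarrow>
     hor K J A B \<and> \<alpha> \<odot>\<^bsub>K\<^esub> J \<preceq>\<^bsub>K\<^esub> onH T J \<odot>\<^bsub>K\<^esub> \<beta>"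

definition T_closed ::
  "('o, 'v, 'h) equipment \<Rightarrow> ('o, 'v, 'h, 'o, 'v, 'h) efunctor
    \<Rightarrow> 'o \<Rightarrow> 'h \<Rightarrow> 'o \<Rightarrow> 'h \<Rightarrow> 'h \<Rightarrow> bool"
  where "T_closed K T A \<alpha> B \<beta> J \<longleftrightarrow>
     hor K J A B \<and> onH T J \<odot>\<^bsub>K\<^esub> \<beta> \<preceq>\<^bsub>K\<^esub> \<alpha> \<odot>\<^bsub>K\<^esub> J"

definition T_closed_morphism ::
  "('o, 'v, 'h) equipment \<Rightarrow> ('o, 'v, 'h, 'o, 'v, 'h) efunctor
    \<Rightarrow> 'o \<Rightarrow> 'h \<Rightarrow> 'o \<Rightarrow> 'h \<Rightarrow> 'v \<Rightarrow> bool"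
  where "T_closed_morphism K T A \<alpha> C \<gamma> f \<longleftrightarrow>
     T_morphism K T A \<alpha> C \<gamma> f \<and> T_closed K T A \<alpha> C \<gamma> (companion K f)"

definition right_Kan_extension ::
  "('o, 'v, 'h) equipment \<Rightarrow> 'o \<Rightarrow> 'o \<Rightarrow> 'o \<Rightarrow> 'h \<Rightarrow> 'v \<Rightarrow> 'v \<Rightarrow> bool"
  where "right_Kan_extension K A B M J e r \<longleftrightarrow>
     hor K J A B \<and> vert K e B M \<and> vert K r A M \<and>
     cell K J r e (hid K M) \<and>
     (\<forall>C H f. hor K H C A \<longrightarrow> vert K f C M \<longrightarrow>
        cell K (H \<odot>\<^bsub>K\<^esub> J) f e (hid K M) \<longrightarrow> cell K H f r (hid K M))"

definition Beck_Chevalley ::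
  "('o, 'v, 'h) equipment \<Rightarrow> 'h \<Rightarrow> 'v \<Rightarrow> 'v \<Rightarrow> bool"
  where "Beck_Chevalley K J e r \<longleftrightarrow> J \<odot>\<^bsub>K\<^esub> companion K e = companion K r"

end

theory Submission imports Defs begin

text \<open>
  Write \<open>f\<^sub>*\<close> for the companion of \<open>f\<close>. Bending the vertical sides of a cell around with
  companions turns the cell \<open>\<alpha> \<Rightarrow>\<^bsub>g,f\<^esub> \<gamma>\<close> into the inequality
  \<open>\<alpha> \<odot> f\<^sub>* \<preceq> g\<^sub>* \<odot> \<gamma>\<close> of horizontal morphisms (\<open>cell_iff_companion_hle\<close>), and a
  normal lax functor preserves companions (\<open>onH_companion\<close>). Hence a vertical \<open>f\<close> is a
  \<open>T\<close>-morphism exactly when \<open>\<alpha> \<odot> f\<^sub>* \<preceq> T (f\<^sub>*) \<odot> \<gamma>\<close>, that is, when its companion is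
  \<open>T\<close>-open, while \<open>T\<close>-closedness of \<open>f\<close> adds the reverse inequality.

  In this form the theorem says that \<open>T\<close>-open and \<open>T\<close>-closed horizontal morphisms compose:
  the Beck-Chevalley condition identifies \<open>r\<^sub>*\<close> with the composite \<open>J \<odot> e\<^sub>*\<close>, so that
  \<open>\<alpha> \<odot> J \<odot> e\<^sub>* \<preceq> T J \<odot> \<beta> \<odot> e\<^sub>* \<preceq> T J \<odot> T (e\<^sub>*) \<odot> \<nu> \<preceq> T (J \<odot> e\<^sub>*) \<odot> \<nu>\<close>.
  The first two steps are reversed when \<open>J\<close> and \<open>e\<close> are closed. The last is the lax
  comparison of \<open>T\<close>, and only this step needs a separate hypothesis to be reversed.
\<close>

context thin_equipment
begin

sublocale vertical: category_on "Obj K" "Ver K" "vdom K" "vcod K" "\<lambda>f g. g \<cdot> f" "vid K"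
  by (rule vertical_category)

sublocale horizontal: category_on "Obj K" "Hor K" "hsrc K" "htgt K" "(\<odot>)" "hid K"
  by (rule horizontal_category)

lemma hle_iff_cell: "hor K J A B \<Longrightarrow> J \<preceq> L \<longleftrightarrow> cell K J (vid K A) (vid K B) L"
  by (auto simp: hle_def hor_def)

lemma hle_refl: "hor K J A B \<Longrightarrow> J \<preceq> J"
  using cell_refl hle_iff_cell by blast

lemma hor_hcomp: "hor K J A B \<Longrightarrow> hor K H B E \<Longrightarrow> hor K (J \<odot> H) A E"
  by (auto simp: hor_def horizontal.comp_in horizontal.dm_comp horizontal.cd_comp)

lemma hcomp_assoc:
  "hor K J A B \<Longrightarrow> hor K H B E \<Longrightarrow> hor K N E D \<Longrightarrow> (J \<odot> H) \<odot> N = J \<odot> (H \<odot> N)"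
  by (auto simp: hor_def horizontal.comp_assoc)

lemma hid_hcomp: "hor K J A B \<Longrightarrow> hid K A \<odot> J = J"
  using horizontal.comp_id_left by (auto simp: hor_def)

lemma hcomp_hid: "hor K J A B \<Longrightarrow> J \<odot> hid K B = J"
  using horizontal.comp_id_right by (auto simp: hor_def)

lemma vcomp_vid: "vert K f A C \<Longrightarrow> f \<cdot> vid K A = f"
  using vertical.comp_id_left by (auto simp: vert_def)

lemma vid_vcomp: "vert K f A C \<Longrightarrow> vid K C \<cdot> f = f"
  using vertical.comp_id_right by (auto simp: vert_def)

lemma hcomp_mono:
  assumes J: "hor K J A B" and H: "hor K H B E" and le: "J \<preceq> J'" "H \<preceq> H'"
  shows "J \<odot> H \<preceq> J' \<odot> H'"
  using cell_hcomp[of J "vid K A" "vid K B" J' H "vid K E" H'] le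
  by (simp add: hle_iff_cell[OF J] hle_iff_cell[OF H] hle_iff_cell[OF hor_hcomp[OF J H]])

lemma companion_props:
  assumes "vert K f A C"
  shows hor_companion: "hor K (companion K f) A C"
    and companion_counit: "cell K (companion K f) f (vid K C) (hid K C)"
    and companion_unit: "cell K (hid K A) (vid K A) f (companion K f)"
  using is_companion_companion[of f] assms by (auto simp: vert_def is_companion_def)

text \<open>Pasting the unit of \<open>g\<close> to the left and the counit of \<open>f\<close> to the right of a cell
  straightens its two vertical sides. Conversely, stacking the unit of \<open>f\<close> on top of the
  inequality and the counit of \<open>g\<close> below it restores them.\<close>

lemma cell_iff_companion_hle:
  assumes \<alpha>: "hor K \<alpha> X A" and \<gamma>: "hor K \<gamma> Y C" and g: "vert K g X Y" and f: "vert K f A C"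
  shows "cell K \<alpha> g f \<gamma> \<longleftrightarrow> \<alpha> \<odot> companion K f \<preceq> companion K g \<odot> \<gamma>"
proof
  assume "cell K \<alpha> g f \<gamma>"
  from cell_hcomp[OF cell_hcomp[OF companion_unit[OF g] this] companion_counit[OF f]]
  have "cell K (\<alpha> \<odot> companion K f) (vid K X) (vid K C) (companion K g \<odot> \<gamma>)"
    using hid_hcomp[OF \<alpha>] hcomp_hid[OF hor_hcomp[OF hor_companion[OF g] \<gamma>]] by simp
  then show "\<alpha> \<odot> companion K f \<preceq> companion K g \<odot> \<gamma>"
    using hle_iff_cell[OF hor_hcomp[OF \<alpha> hor_companion[OF f]]] by blast
next
  assume "\<alpha> \<odot> companion K f \<preceq> companion K g \<odot> \<gamma>"
  then have straight: "cell K (\<alpha> \<odot> companion K f) (vid K X) (vid K C) (companion K g \<odot> \<gamma>)"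
    using hle_iff_cell[OF hor_hcomp[OF \<alpha> hor_companion[OF f]]] by blast
  have top: "cell K \<alpha> (vid K X) f (\<alpha> \<odot> companion K f)"
    using cell_hcomp[OF cell_refl[OF \<alpha>] companion_unit[OF f]] hcomp_hid[OF \<alpha>] by simp
  have bottom: "cell K (companion K g \<odot> \<gamma>) g (vid K C) \<gamma>"
    using cell_hcomp[OF companion_counit[OF g] cell_refl[OF \<gamma>]] hid_hcomp[OF \<gamma>] by simp
  have "X \<in> Obj K"
    using g vertical.dm_in by (auto simp: vert_def)
  then have "vert K (vid K X) X X"
    by (simp add: vert_def vertical.id_in vertical.dm_id vertical.cd_id)
  then show "cell K \<alpha> g f \<gamma>"
    using cell_vcomp[OF cell_vcomp[OF top straight] bottom]
    by (simp add: vid_vcomp[OF f] vcomp_vid[OF g] vid_vcomp)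
qed

end

text \<open>The unit and counit cells of \<open>f\<^sub>*\<close> have horizontal identities on their boundaries.
  Normality sends these to horizontal identities, so the images of the two cells exhibit
  \<open>F (f\<^sub>*)\<close> as a companion of \<open>F f\<close>.\<close>

lemma (in lax_functor) onH_companion:
  assumes "normal K L F" and f: "vert K f A C"
  shows "onH F (companion K f) = companion L (onV F f)"
proof -
  have ob: "A \<in> Obj K" "C \<in> Obj K"
    using f dom.vertical.dm_in dom.vertical.cd_in by (auto simp: vert_def)
  have Ff: "vert L (onV F f) (onO F A) (onO F C)"
    by (rule onV_vert[OF f])
  have "is_companion L (onV F f) (onH F (companion K f))"
    using onH_hor[OF dom.hor_companion[OF f]] on_cell[OF dom.companion_counit[OF f]]
      on_cell[OF dom.companion_unit[OF f]] Ff ob assms(1)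
    by (auto simp: is_companion_def vert_def normal_def onV_vid)
  moreover have "is_companion L (onV F f) (companion L (onV F f))"
    using cod.is_companion_companion Ff by (auto simp: vert_def)
  ultimately show ?thesis
    using Ff cod.companion_hle cod.hle_antisym by (auto simp: vert_def)
qed

context normal_lax_monad
begin

lemma T_morphism_iff_T_open_companion:
  assumes "T_graph K T \<iota> A \<alpha>" and "T_graph K T \<iota> C \<gamma>" and f: "vert K f A C"
  shows "T_morphism K T A \<alpha> C \<gamma> f \<longleftrightarrow> T_open K T A \<alpha> C \<gamma> (companion K f)"
  using T.dom.cell_iff_companion_hle[OF _ _ T.onV_vert[OF f] f] assms
    T.onH_companion[OF normal f] T.dom.hor_companion[OF f]
  by (auto simp: T_morphism_def T_open_def T_graph_def)

lemma T_open_hcomp: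
  assumes A: "T_graph K T \<iota> A \<alpha>" and B: "T_graph K T \<iota> B \<beta>" and M: "T_graph K T \<iota> M \<nu>"
    and J: "T_open K T A \<alpha> B \<beta> J" and H: "T_open K T B \<beta> M \<nu> H"
  shows "T_open K T A \<alpha> M \<nu> (J \<odot>\<^bsub>K\<^esub> H)"
proof -
  have \<alpha>: "hor K \<alpha> (onO T A) A" and \<beta>: "hor K \<beta> (onO T B) B" and \<nu>: "hor K \<nu> (onO T M) M"
    using A B M by (auto simp: T_graph_def)
  have hJ: "hor K J A B" and hH: "hor K H B M"
    and openJ: "\<alpha> \<odot>\<^bsub>K\<^esub> J \<preceq>\<^bsub>K\<^esub> onH T J \<odot>\<^bsub>K\<^esub> \<beta>" and openH: "\<beta> \<odot>\<^bsub>K\<^esub> H \<preceq>\<^bsub>K\<^esub> onH T H \<odot>\<^bsub>K\<^esub> \<nu>"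
    using J H by (auto simp: T_open_def)
  note TJ = T.onH_hor[OF hJ] and TH = T.onH_hor[OF hH]
  note comps = T.dom.hor_hcomp[OF \<alpha> hJ] T.dom.hor_hcomp[OF TJ TH] T.dom.hor_hcomp[OF \<beta> hH]
  have "(\<alpha> \<odot>\<^bsub>K\<^esub> J) \<odot>\<^bsub>K\<^esub> H \<preceq>\<^bsub>K\<^esub> (onH T J \<odot>\<^bsub>K\<^esub> \<beta>) \<odot>\<^bsub>K\<^esub> H"
    by (rule T.dom.hcomp_mono[OF comps(1) hH openJ T.dom.hle_refl[OF hH]])
  moreover have "onH T J \<odot>\<^bsub>K\<^esub> (\<beta> \<odot>\<^bsub>K\<^esub> H) \<preceq>\<^bsub>K\<^esub> onH T J \<odot>\<^bsub>K\<^esub> (onH T H \<odot>\<^bsub>K\<^esub> \<nu>)"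
    by (rule T.dom.hcomp_mono[OF TJ comps(3) T.dom.hle_refl[OF TJ] openH])
  moreover have "(onH T J \<odot>\<^bsub>K\<^esub> onH T H) \<odot>\<^bsub>K\<^esub> \<nu> \<preceq>\<^bsub>K\<^esub> onH T (J \<odot>\<^bsub>K\<^esub> H) \<odot>\<^bsub>K\<^esub> \<nu>"
    by (rule T.dom.hcomp_mono[OF comps(2) \<nu> T.onH_hcomp[OF hJ hH] T.dom.hle_refl[OF \<nu>]])
  ultimately show ?thesis
    using T.dom.hle_trans T.dom.hor_hcomp[OF hJ hH]
    by (metis T_open_def T.dom.hcomp_assoc[OF \<alpha> hJ hH] T.dom.hcomp_assoc[OF TJ \<beta> hH]
        T.dom.hcomp_assoc[OF TJ TH \<nu>])
qed

text \<open>Unlike for open morphisms, the lax comparison points the wrong way here, so that its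
  invertibility has to be assumed.\<close>

lemma T_closed_hcomp:
  assumes A: "T_graph K T \<iota> A \<alpha>" and B: "T_graph K T \<iota> B \<beta>" and M: "T_graph K T \<iota> M \<nu>"
    and J: "T_closed K T A \<alpha> B \<beta> J" and H: "T_closed K T B \<beta> M \<nu> H"
    and strict: "onH T J \<odot>\<^bsub>K\<^esub> onH T H = onH T (J \<odot>\<^bsub>K\<^esub> H)"
  shows "T_closed K T A \<alpha> M \<nu> (J \<odot>\<^bsub>K\<^esub> H)"
proof -
  have \<alpha>: "hor K \<alpha> (onO T A) A" and \<beta>: "hor K \<beta> (onO T B) B" and \<nu>: "hor K \<nu> (onO T M) M"
    using A B M by (auto simp: T_graph_def)
  have hJ: "hor K J A B" and hH: "hor K H B M"
    and closedJ: "onH T J \<odot>\<^bsub>K\<^esub> \<beta> \<preceq>\<^bsub>K\<^esub> \<alpha> \<odot>\<^bsub>K\<^esub> J"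
    and closedH: "onH T H \<odot>\<^bsub>K\<^esub> \<nu> \<preceq>\<^bsub>K\<^esub> \<beta> \<odot>\<^bsub>K\<^esub> H"
    using J H by (auto simp: T_closed_def)
  note TJ = T.onH_hor[OF hJ] and TH = T.onH_hor[OF hH]
  note comps = T.dom.hor_hcomp[OF TH \<nu>] T.dom.hor_hcomp[OF TJ \<beta>]
  have "onH T J \<odot>\<^bsub>K\<^esub> (onH T H \<odot>\<^bsub>K\<^esub> \<nu>) \<preceq>\<^bsub>K\<^esub> onH T J \<odot>\<^bsub>K\<^esub> (\<beta> \<odot>\<^bsub>K\<^esub> H)"
    by (rule T.dom.hcomp_mono[OF TJ comps(1) T.dom.hle_refl[OF TJ] closedH])
  moreover have "(onH T J \<odot>\<^bsub>K\<^esub> \<beta>) \<odot>\<^bsub>K\<^esub> H \<preceq>\<^bsub>K\<^esub> (\<alpha> \<odot>\<^bsub>K\<^esub> J) \<odot>\<^bsub>K\<^esub> H"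
    by (rule T.dom.hcomp_mono[OF comps(2) hH closedJ T.dom.hle_refl[OF hH]])
  ultimately show ?thesis
    using T.dom.hle_trans T.dom.hor_hcomp[OF hJ hH] strict
    by (metis T_closed_def T.dom.hcomp_assoc[OF \<alpha> hJ hH] T.dom.hcomp_assoc[OF TJ \<beta> hH]
        T.dom.hcomp_assoc[OF TJ TH \<nu>])
qed

end

theorem theorem7p6:
  fixes K :: "('o, 'v, 'h) equipment"
    and T :: "('o, 'v, 'h, 'o, 'v, 'h) efunctor"
    and \<mu> \<iota> :: "'o \<Rightarrow> 'v"
    and A B M :: 'o and \<alpha> \<beta> \<nu> J :: 'h and e r :: 'v
  assumes "normal_lax_monad K T \<mu> \<iota>"
    and "T_graph K T \<iota> A \<alpha>" and "T_graph K T \<iota> B \<beta>" and "T_graph K T \<iota> M \<nu>"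
    and "T_morphism K T B \<beta> M \<nu> e"
    and "T_open K T A \<alpha> B \<beta> J"
    and "right_Kan_extension K A B M J e r"
    and "Beck_Chevalley K J e r"
  shows "T_morphism K T A \<alpha> M \<nu> r \<and>
    (T_closed_morphism K T B \<beta> M \<nu> e \<longrightarrow>
     T_closed K T A \<alpha> B \<beta> J \<longrightarrow>
     onH T J \<odot>\<^bsub>K\<^esub> onH T (companion K e) = onH T (J \<odot>\<^bsub>K\<^esub> companion K e) \<longrightarrow>
     T_closed_morphism K T A \<alpha> M \<nu> r)"
proof -
  interpret normal_lax_monad K T \<mu> \<iota> by (rule assms(1))
  note graphs = assms(2,3,4)
  have e: "vert K e B M" and r: "vert K r A M"
    using assms(7) by (auto simp: right_Kan_extension_def)
  have BC: "J \<odot>\<^bsub>K\<^esub> companion K e = companion K r"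
    using assms(8) by (simp add: Beck_Chevalley_def)
  have "T_open K T B \<beta> M \<nu> (companion K e)"
    using T_morphism_iff_T_open_companion[OF graphs(2,3) e] assms(5) by blast
  then have "T_open K T A \<alpha> M \<nu> (companion K r)"
    using T_open_hcomp[OF graphs assms(6)] BC by metis
  then have morphism: "T_morphism K T A \<alpha> M \<nu> r"
    using T_morphism_iff_T_open_companion[OF graphs(1,3) r] by blast
  have "T_closed_morphism K T A \<alpha> M \<nu> r"
    if "T_closed_morphism K T B \<beta> M \<nu> e" and J: "T_closed K T A \<alpha> B \<beta> J"
      and strict: "onH T J \<odot>\<^bsub>K\<^esub> onH T (companion K e) = onH T (J \<odot>\<^bsub>K\<^esub> companion K e)"
  proof -
    have "T_closed K T B \<beta> M \<nu> (companion K e)"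
      using that(1) by (simp add: T_closed_morphism_def)
    from T_closed_hcomp[OF graphs J this strict]
    show ?thesis
      using morphism BC by (simp add: T_closed_morphism_def)
  qed
  with morphism show ?thesis by blast
qed

end
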